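(* Let $\gamma\in\mathbb{R}^n$, let $\rho\ge0$ be a threshold, let $H=\frac1\eta\left(\mathrm{diag}(P^\top a)-P^\top\mathrm{diag}(a)P\right)$ with $P=P^k(\gamma)$, and let $H_\rho=\frac1\eta\left(\mathrm{diag}(P_\rho^\top a)-P_\rho^\top\,\mathrm{diag}(a)\,P_\rho\right)$ be the matrix obtained from the sparsification procedure. Then $$\|H-H_\rho\|\le\frac{6mn\|a\|_\infty}{\eta}\,\rho,$$ where $\|\cdot\|$ on matrices is the $\ell_2$ induced (spectral) norm.
   Context: Data: positive integers $m,n$, a cost matrix $C\in\mathbb{R}^{m\times n}$ with nonnegative entries, vectors $a\in\mathbb{R}^m$, $b\in\mathbb{R}^n$ with strictly positive entries and $\sum_i a_i=\sum_j b_j=1$, a parameter $\eta>0$, and a matrix $X^k\in\mathbb{R}^{m\times n}$ with strictly positive entries (the current outer iterate of an iterative scheme started at $X^0=ab^\top$). For $\gamma\in\mathbb{R}^n$, $P=P^k(\gamma)\in\mathbb{R}^{m\times n}$ has entries $$P_{ij}=\frac{X^k_{ij}\exp((\gamma_j-C_{ij})/\eta)}{\sum_{l=1}^n X^k_{il}\exp((\gamma_l-C_{il})/\eta)}.$$ Sparsification procedure: let $i^\star=\arg\max_{i}a_i$. For a threshold $\rho\ge0$ define $P_\rho\in\mathbb{R}^{m\times n}$ by $$[P_\rho]_{ij}=\frac{P_{ij}\mathbf 1_{\{P_{ij}\ge\rho\}}}{\sum_{l=1}^n P_{il}\mathbf 1_{\{P_{il}\ge\rho\}}}\quad (i\ne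 i^\star),\qquad [P_\rho]_{i^\star j}=P_{i^\star j}.$$ *)

theory Defs
  imports "HOL-Analysis.Analysis"
begin

text \<open>
  An \<open>m \<times> n\<close> real matrix has type \<open>real ^ 'n ^ 'm\<close>, with \<open>CARD('m) = m\<close> rows and
  \<open>CARD('n) = n\<close> columns; \<open>A $ i $ j\<close> is the entry in row \<open>i\<close> and column \<open>j\<close>.
\<close>

definition diag_mat :: "real ^ 'k \<Rightarrow> real ^ 'k ^ 'k" where
  "diag_mat v = (\<chi> i j. if i = j then v $ i else 0)"

definition plan ::
  "real \<Rightarrow> real ^ 'n ^ 'm \<Rightarrow> real ^ 'n ^ 'm \<Rightarrow> real ^ 'n \<Rightarrow> real ^ 'n ^ 'm" where
  "plan \<eta> C X \<gamma> = (\<chi> i j.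
     X $ i $ j * exp ((\<gamma> $ j - C $ i $ j) / \<eta>) /
     (\<Sum>l\<in>UNIV. X $ i $ l * exp ((\<gamma> $ l - C $ i $ l) / \<eta>)))"

text \<open>
  Row \<open>istar\<close> is left untouched. If \<open>\<rho>\<close> exceeds every entry of some other row, the
  normalising sum of that row is \<open>0\<close>, and by the convention \<open>x / 0 = 0\<close> the whole row
  becomes \<open>0\<close>.
\<close>

definition sparsify :: "'m \<Rightarrow> real \<Rightarrow> real ^ 'n ^ 'm \<Rightarrow> real ^ 'n ^ 'm" where
  "sparsify istar \<rho> P = (\<chi> i j.
     if i = istar then P $ i $ j
     else P $ i $ j * of_bool (P $ i $ j \<ge> \<rho>) /
          (\<Sum>l\<in>UNIV. P $ i $ l * of_bool (P $ i $ l \<ge> \<rho>)))"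

definition hess :: "real \<Rightarrow> real ^ 'm \<Rightarrow> real ^ 'n ^ 'm \<Rightarrow> real ^ 'n ^ 'n" where
  "hess \<eta> a P =
     (1 / \<eta>) *\<^sub>R (diag_mat (transpose P *v a) - transpose P ** diag_mat a ** P)"

end

theory Submission
  imports Defs
begin

text \<open>
  A Hessian is the \<open>a\<close>-weighted sum over the rows \<open>p\<close> of \<open>diag p - p p\<^sup>T\<close>, divided by \<open>\<eta>\<close>.
  For subprobability vectors, \<open>p \<mapsto> diag p - p p\<^sup>T\<close> is 3-Lipschitz from the
  \<open>\<ell>\<^sub>1\<close> norm to the spectral norm, since \<open>p p\<^sup>T - q q\<^sup>T = p (p - q)\<^sup>T + (p - q) q\<^sup>T\<close>.
  Thresholding discards mass at most \<open>n \<rho>\<close> from a row and the renormalisation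
  moves the same amount again, so each row changes by at most \<open>2 n \<rho>\<close> in \<open>\<ell>\<^sub>1\<close>.
\<close>

definition l1norm :: "real ^ 'n \<Rightarrow> real" where
  "l1norm v = (\<Sum>j\<in>UNIV. \<bar>v $ j\<bar>)"

lemma norm_le_l1norm: "norm v \<le> l1norm v"
  unfolding l1norm_def by (rule norm_le_l1_cart)

text \<open>The matrix \<open>diag p - p p^T\<close> acting on \<open>x\<close>; for a probability
  vector \<open>p\<close> it is the covariance matrix of a random unit coordinate vector with law
  \<open>p\<close>. Working with the action on vectors suits the pointwise criterion
  \<open>onorm_le\<close>.\<close>

definition cov_apply :: "real ^ 'n \<Rightarrow> real ^ 'n \<Rightarrow> real ^ 'n" where
  "cov_apply p x = (\<chi> j. p $ j * x $ j) - (p \<bullet> x) *\<^sub>R p"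

lemma hess_mult_vec:
  "hess \<eta> a P *v x = (1 / \<eta>) *\<^sub>R (\<Sum>i\<in>UNIV. a $ i *\<^sub>R cov_apply (P $ i) x)"
proof -
  have diag: "(diag_mat v *v y) $ k = v $ k * y $ k" for v y :: "real ^ 'k" and k
    by (simp add: diag_mat_def matrix_vector_mult_def if_distrib[where f = "\<lambda>t. t * _"] cong: if_cong)
  have "(diag_mat (transpose P *v a) - transpose P ** diag_mat a ** P) *v x
      = (\<Sum>i\<in>UNIV. a $ i *\<^sub>R cov_apply (P $ i) x)" (is "?M *v x = ?R")
  proof (subst vec_eq_iff, intro allI)
    fix j
    \<comment> \<open>Reassociating the triple product as \<open>P^T (diag a (P x))\<close> leaves
      only matrix-vector products to expand.\<close>
    have "(?M *v x) $ j = (diag_mat (transpose P *v a) *v x) $ j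
        - (transpose P *v (diag_mat a *v (P *v x))) $ j"
      by (simp add: matrix_vector_mult_diff_rdistrib matrix_vector_mul_assoc[symmetric])
    also have "\<dots> = (\<Sum>i\<in>UNIV. P $ i $ j * a $ i) * x $ j
        - (\<Sum>i\<in>UNIV. P $ i $ j * (a $ i * (P $ i \<bullet> x)))"
      unfolding diag
      by (simp add: transpose_def matrix_vector_mul_component[of _ _ j]
          inner_vec_def[of "\<chi> i. P $ i $ j"] diag) (simp add: matrix_vector_mul_component)
    also have "\<dots> = (\<Sum>i\<in>UNIV. a $ i *\<^sub>R cov_apply (P $ i) x) $ j"
      by (simp add: cov_apply_def sum_distrib_left sum_subtractf algebra_simps)
    finally show "(?M *v x) $ j = ?R $ j" .
  qed
  then show ?thesis
    by (simp add: hess_def flip: scaleR_matrix_vector_assoc)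
qed

lemma norm_cov_apply_diff_le:
  fixes p q x :: "real ^ 'n"
  assumes "l1norm p \<le> 1" and "l1norm q \<le> 1"
  shows "norm (cov_apply p x - cov_apply q x) \<le> 3 * l1norm (p - q) * norm x"
proof -
  define d where "d = p - q"
  \<comment> \<open>The diagonal part is linear in \<open>d\<close>. Each of the three terms will
    cost one \<open>l1norm d * norm x\<close>, whence the constant 3.\<close>
  have split: "cov_apply p x - cov_apply q x
      = (\<chi> j. d $ j * x $ j) - (d \<bullet> x) *\<^sub>R p - (q \<bullet> x) *\<^sub>R d"
    by (simp add: d_def cov_apply_def vec_eq_iff algebra_simps)
  have "norm (\<chi> j. d $ j * x $ j) \<le> (\<Sum>j\<in>UNIV. \<bar>d $ j * x $ j\<bar>)"
    using norm_le_l1_cart[of "\<chi> j. d $ j * x $ j"] by simp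
  also have "\<dots> \<le> (\<Sum>j\<in>UNIV. \<bar>d $ j\<bar> * norm x)"
    by (intro sum_mono) (simp add: abs_mult component_le_norm_cart mult_left_mono)
  finally have diag: "norm (\<chi> j. d $ j * x $ j) \<le> l1norm d * norm x"
    by (simp add: l1norm_def sum_distrib_right)
  \<comment> \<open>Cauchy-Schwarz, then both Euclidean norms are weakened to \<open>l1norm\<close>,
    so that the hypotheses on \<open>p\<close> and \<open>q\<close> can absorb one factor.\<close>
  have rank1: "norm ((u \<bullet> x) *\<^sub>R v) \<le> l1norm u * l1norm v * norm x" for u v :: "real ^ 'n"
  proof -
    have "norm ((u \<bullet> x) *\<^sub>R v) \<le> (norm u * norm x) * norm v"
      by (simp add: Cauchy_Schwarz_ineq2 mult_right_mono)
    also have "\<dots> = (norm u * norm v) * norm x" by simp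
    also have "\<dots> \<le> (l1norm u * l1norm v) * norm x"
      by (intro mult_right_mono mult_mono norm_le_l1norm) (auto simp: l1norm_def sum_nonneg)
    finally show ?thesis .
  qed
  have nn: "0 \<le> l1norm d" by (simp add: l1norm_def sum_nonneg)
  have "l1norm d * l1norm p * norm x \<le> l1norm d * 1 * norm x"
    using assms nn by (intro mult_right_mono mult_left_mono) auto
  then have dp: "norm ((d \<bullet> x) *\<^sub>R p) \<le> l1norm d * norm x"
    using rank1[of d p] by simp
  have "l1norm q * l1norm d * norm x \<le> 1 * l1norm d * norm x"
    using assms nn by (intro mult_right_mono) auto
  then have qd: "norm ((q \<bullet> x) *\<^sub>R d) \<le> l1norm d * norm x"
    using rank1[of q d] by simp
  have "norm (cov_apply p x - cov_apply q x)
      \<le> norm (\<chi> j. d $ j * x $ j) + norm ((d \<bullet> x) *\<^sub>R p) + norm ((q \<bullet> x) *\<^sub>R d)"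
    unfolding split by (intro norm_triangle_le_diff add_right_mono norm_triangle_ineq4)
  then show ?thesis
    using diag dp qd by (simp add: d_def)
qed

lemma threshold_l1norm:
  fixes p :: "real ^ 'n" and \<rho> :: real
  assumes nonneg: "\<And>j. 0 \<le> p $ j" and total: "(\<Sum>j\<in>UNIV. p $ j) = 1"
  defines "q \<equiv> (\<chi> j. p $ j * of_bool (p $ j \<ge> \<rho>) / (\<Sum>l\<in>UNIV. p $ l * of_bool (p $ l \<ge> \<rho>)))"
  assumes "\<rho> \<ge> 0"
  shows "l1norm q \<le> 1" and "l1norm (p - q) \<le> 2 * real CARD('n) * \<rho>"
proof -
  define k where "k j = p $ j * of_bool (p $ j \<ge> \<rho>)" for j
  define s where "s = (\<Sum>l\<in>UNIV. k l)"
  have q: "q $ j = k j / s" for j by (simp add: q_def k_def s_def)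
  have k0: "0 \<le> k j" and kp: "k j \<le> p $ j" for j
    using nonneg[of j] by (auto simp: k_def)
  have s0: "0 \<le> s" unfolding s_def by (simp add: k0 sum_nonneg)
  have s1: "s \<le> 1" unfolding s_def total[symmetric] by (intro sum_mono kp)
  \<comment> \<open>The quotient is 1 if some mass survives. If the whole row is cut, it is
    \<open>0 / 0 = 0\<close>, which is why only an inequality is claimed for
    \<open>l1norm q\<close>.\<close>
  have q1: "l1norm q = s / s"
    by (simp add: l1norm_def q k0 s0 sum_divide_distrib[symmetric]) (simp add: s_def)
  then show "l1norm q \<le> 1" by simp
  have "1 - s = (\<Sum>j\<in>UNIV. p $ j - k j)"
    by (simp add: s_def total sum_subtractf)
  \<comment> \<open>A kept entry loses nothing, and a dropped one loses its own value, which is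
    below \<rho>.\<close>
  also have "\<dots> \<le> (\<Sum>j\<in>(UNIV :: 'n set). \<rho>)"
    using \<open>\<rho> \<ge> 0\<close> by (intro sum_mono) (simp add: k_def)
  finally have drop: "1 - s \<le> real CARD('n) * \<rho>" by simp
  \<comment> \<open>The truncated but not renormalised row \<open>k\<close> serves as an
    intermediate point between \<open>p\<close> and \<open>q\<close>.\<close>
  have "l1norm (p - q) \<le> (\<Sum>j\<in>UNIV. (p $ j - k j) + \<bar>k j - q $ j\<bar>)"
    unfolding l1norm_def using kp by (intro sum_mono) (smt (verit) vector_minus_component)
  also have "\<dots> = (1 - s) + (\<Sum>j\<in>UNIV. \<bar>k j - q $ j\<bar>)"
    by (simp add: sum.distrib sum_subtractf total s_def)
  also have "(\<Sum>j\<in>UNIV. \<bar>k j - q $ j\<bar>) \<le> 1 - s"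
  proof (cases "s = 0")
    case True
    then have "k j = 0" for j
      using k0 by (simp add: s_def sum_nonneg_eq_0_iff)
    then show ?thesis using s1 by (simp add: q)
  next
    case False
    with s0 have "s > 0" by simp
    \<comment> \<open>Dividing by \<open>s \<le> 1\<close> only increases entries, so the distance
      from \<open>k\<close> to \<open>q\<close> is the difference of their total masses,
      \<open>1 - s\<close>.\<close>
    have "k j \<le> q $ j" for j
      using \<open>s > 0\<close> s1 k0[of j] by (simp add: q field_simps mult_left_le_one_le)
    then have "\<bar>k j - q $ j\<bar> = q $ j - k j" for j
      by (simp add: abs_of_nonpos)
    moreover have "(\<Sum>j\<in>UNIV. q $ j) = 1"
      using \<open>s > 0\<close> by (simp add: q sum_divide_distrib[symmetric] s_def[symmetric])
    ultimately show ?thesis by (simp add: sum_subtractf s_def)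
  qed
  finally show "l1norm (p - q) \<le> 2 * real CARD('n) * \<rho>" using drop by simp
qed

lemma sparsify_row_l1norm:
  fixes P :: "real ^ 'n ^ 'm"
  assumes "\<And>j. 0 \<le> P $ i $ j" and "(\<Sum>j\<in>UNIV. P $ i $ j) = 1" and "\<rho> \<ge> 0"
  shows "l1norm (sparsify istar \<rho> P $ i) \<le> 1"
    and "l1norm (P $ i - sparsify istar \<rho> P $ i) \<le> 2 * real CARD('n) * \<rho>"
proof -
  have "l1norm (sparsify istar \<rho> P $ i) \<le> 1
      \<and> l1norm (P $ i - sparsify istar \<rho> P $ i) \<le> 2 * real CARD('n) * \<rho>"
  proof (cases "i = istar")
    case True
    then have "sparsify istar \<rho> P $ i = P $ i"
      by (simp add: sparsify_def vec_eq_iff)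
    then show ?thesis using assms by (simp add: l1norm_def)
  next
    case False
    then show ?thesis
      using threshold_l1norm[of "P $ i", OF assms] by (simp add: sparsify_def)
  qed
  then show "l1norm (sparsify istar \<rho> P $ i) \<le> 1"
    and "l1norm (P $ i - sparsify istar \<rho> P $ i) \<le> 2 * real CARD('n) * \<rho>" by auto
qed

lemma plan_row_stochastic:
  assumes "\<And>i j. X $ i $ j > 0"
  shows "0 \<le> plan \<eta> C X \<gamma> $ i $ j" and "(\<Sum>j\<in>UNIV. plan \<eta> C X \<gamma> $ i $ j) = 1"
proof -
  let ?S = "\<Sum>l\<in>UNIV. X $ i $ l * exp ((\<gamma> $ l - C $ i $ l) / \<eta>)"
  have "?S > 0" using assms by (intro sum_pos) auto
  then show "0 \<le> plan \<eta> C X \<gamma> $ i $ j" and "(\<Sum>j\<in>UNIV. plan \<eta> C X \<gamma> $ i $ j) = 1"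
    using assms by (auto simp: plan_def sum_divide_distrib[symmetric] less_imp_le)
qed

text \<open>By the triangle inequality over the rows: each weight is at most
  \<open>infnorm a\<close> and there are \<open>CARD('m)\<close> rows, so the Lipschitz bound
  \<open>3 * \<delta>\<close> of a single row is multiplied by both.\<close>

lemma onorm_hess_diff_le:
  fixes P Q :: "real ^ 'n ^ 'm"
  assumes "\<eta> > 0"
    and "\<And>i. l1norm (P $ i) \<le> 1" and "\<And>i. l1norm (Q $ i) \<le> 1"
    and close: "\<And>i. l1norm (P $ i - Q $ i) \<le> \<delta>"
  shows "onorm ((*v) (hess \<eta> a P - hess \<eta> a Q)) \<le> 3 * real CARD('m) * infnorm a / \<eta> * \<delta>"
proof (rule onorm_le)
  fix x
  have "norm (a $ i *\<^sub>R (cov_apply (P $ i) x - cov_apply (Q $ i) x))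
      \<le> infnorm a * (3 * \<delta> * norm x)" for i
  proof -
    have "norm (cov_apply (P $ i) x - cov_apply (Q $ i) x) \<le> 3 * l1norm (P $ i - Q $ i) * norm x"
      using assms by (intro norm_cov_apply_diff_le)
    also have "\<dots> \<le> 3 * \<delta> * norm x"
      using close by (intro mult_right_mono) auto
    finally show ?thesis
      by (simp add: mult_mono component_le_infnorm_cart infnorm_pos_le)
  qed
  then have "norm (\<Sum>i\<in>UNIV. a $ i *\<^sub>R (cov_apply (P $ i) x - cov_apply (Q $ i) x))
      \<le> (\<Sum>i\<in>(UNIV :: 'm set). infnorm a * (3 * \<delta> * norm x))"
    by (intro sum_norm_le)
  moreover have "(hess \<eta> a P - hess \<eta> a Q) *v x
      = (1 / \<eta>) *\<^sub>R (\<Sum>i\<in>UNIV. a $ i *\<^sub>R (cov_apply (P $ i) x - cov_apply (Q $ i) x))"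
    by (simp add: matrix_vector_mult_diff_rdistrib hess_mult_vec sum_subtractf scaleR_diff_right)
  ultimately show "norm ((hess \<eta> a P - hess \<eta> a Q) *v x)
      \<le> 3 * real CARD('m) * infnorm a / \<eta> * \<delta> * norm x"
    using \<open>\<eta> > 0\<close> by (simp add: field_simps)
qed

theorem theorem3p4:
  fixes C X :: "real ^ 'n ^ 'm" and a :: "real ^ 'm" and b \<gamma> :: "real ^ 'n"
    and \<eta> \<rho> :: real and istar :: 'm
  assumes "\<And>i j. C $ i $ j \<ge> 0"
    and "\<And>i. a $ i > 0" and "(\<Sum>i\<in>UNIV. a $ i) = 1"
    and "\<And>j. b $ j > 0" and "(\<Sum>j\<in>UNIV. b $ j) = 1"
    and "\<eta> > 0"
    and "\<And>i j. X $ i $ j > 0"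
    and "is_arg_max (\<lambda>i. a $ i) (\<lambda>_. True) istar"
    and "\<rho> \<ge> 0"
  shows "onorm ((*v) (hess \<eta> a (plan \<eta> C X \<gamma>) - hess \<eta> a (sparsify istar \<rho> (plan \<eta> C X \<gamma>))))
    \<le> 6 * real CARD('m) * real CARD('n) * infnorm a / \<eta> * \<rho>"
proof -
  define P where "P = plan \<eta> C X \<gamma>"
  have nonneg: "\<And>i j. 0 \<le> P $ i $ j" and total: "\<And>i. (\<Sum>j\<in>UNIV. P $ i $ j) = 1"
    unfolding P_def using assms(7) by (auto intro: plan_row_stochastic)
  \<comment> \<open>The row distance is \<delta> = \<open>2 * real CARD('n) * \<rho>\<close>: one
    half for the discarded mass, one for the renormalisation. With the factor 3 this makes
    6.\<close>
  have "onorm ((*v) (hess \<eta> a P - hess \<eta> a (sparsify istar \<rho> P)))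
      \<le> 3 * real CARD('m) * infnorm a / \<eta> * (2 * real CARD('n) * \<rho>)"
    using \<open>\<eta> > 0\<close> \<open>\<rho> \<ge> 0\<close> nonneg total
    by (intro onorm_hess_diff_le sparsify_row_l1norm) (simp_all add: l1norm_def)
  then show ?thesis by (simp add: P_def mult_ac)
qed

end
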